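(* Let $\Sigma$ be a finite group. For $n\ge 6$, $$\mathrm{Hom}(K_n,\Sigma)=\mathrm{Hom}(K_n,\Sigma^{(r)}),$$ where $r\ge 0$ is the smallest integer such that $\Sigma^{(r+1)}=\Sigma^{(r)}$; that is, every homomorphism $K_n\to\Sigma$ has image contained in $\Sigma^{(r)}$.
   Context: $K_n$ is the commutator subgroup of the braid group $B_n$ on $n$ strands. $\Sigma^{(k)}$ denotes the derived series: $\Sigma^{(0)}=\Sigma$ and $\Sigma^{(k+1)}=[\Sigma^{(k)},\Sigma^{(k)}]$. For a subgroup $\Sigma'\subset\Sigma$, $\mathrm{Hom}(K_n,\Sigma')$ is regarded as the subset of $\mathrm{Hom}(K_n,\Sigma)$ of homomorphisms with image in $\Sigma'$. *)

theory Defs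
  imports "HOL-Algebra.Solvable_Groups"
begin

text \<open>
  The group with generators \<open>X\<close> and defining relations \<open>u = v\<close>, \<open>(u, v) \<in> R\<close>, as the words in signed
  generators modulo the least congruence that contains \<open>R\<close> and cancels inverse letters.
  The letter \<open>(x, True)\<close> is \<open>x\<close> and \<open>(x, False)\<close> is its inverse.
\<close>

type_synonym 'a word = "('a \<times> bool) list"

definition words :: "'a set \<Rightarrow> 'a word set"
  where "words X = lists (X \<times> UNIV)"

inductive_set word_congr :: "'a set \<Rightarrow> ('a word \<times> 'a word) set \<Rightarrow> ('a word \<times> 'a word) set"
  for X :: "'a set" and R :: "('a word \<times> 'a word) set"
where
  refl: "u \<in> words X \<Longrightarrow> (u, u) \<in> word_congr X R"
| sym: "(u, v) \<in> word_congr X R \<Longrightarrow> (v, u) \<in> word_congr X R"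
| trans: "(u, v) \<in> word_congr X R \<Longrightarrow> (v, w) \<in> word_congr X R \<Longrightarrow> (u, w) \<in> word_congr X R"
| append: "(u, u') \<in> word_congr X R \<Longrightarrow> (v, v') \<in> word_congr X R \<Longrightarrow>
    (u @ v, u' @ v') \<in> word_congr X R"
| cancel: "x \<in> X \<Longrightarrow> ([(x, b), (x, \<not> b)], []) \<in> word_congr X R"
| relation: "(u, v) \<in> R \<Longrightarrow> u \<in> words X \<Longrightarrow> v \<in> words X \<Longrightarrow> (u, v) \<in> word_congr X R"

definition presented_group :: "'a set \<Rightarrow> ('a word \<times> 'a word) set \<Rightarrow> 'a word set monoid"
  where "presented_group X R =
    \<lparr>carrier = words X // word_congr X R,
     mult = (\<lambda>A B. \<Union>u\<in>A. \<Union>v\<in>B. word_congr X R `` {u @ v}),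
     one = word_congr X R `` {[]}\<rparr>"

text \<open>The Artin presentation, where the generator \<open>i\<close> is the half twist of strands \<open>i\<close> and \<open>i + 1\<close>.\<close>

definition braid_relations :: "(nat word \<times> nat word) set"
  where "braid_relations =
    {([(i, True), (j, True)], [(j, True), (i, True)]) | i j. i + 2 \<le> j} \<union>
    {([(i, True), (i + 1, True), (i, True)], [(i + 1, True), (i, True), (i + 1, True)]) | i. True}"

definition braid_group :: "nat \<Rightarrow> nat word set monoid"
  where "braid_group n = presented_group {1..<n} braid_relations"

definition braid_commutator_subgroup :: "nat \<Rightarrow> nat word set monoid"
  where "braid_commutator_subgroup n =
    (braid_group n)\<lparr>carrier := derived (braid_group n) (carrier (braid_group n))\<rparr>"

definition derived_series :: "('a, 'b) monoid_scheme \<Rightarrow> nat \<Rightarrow> ('a, 'b) monoid_scheme"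
  where "derived_series G k = G\<lparr>carrier := (derived G ^^ k) (carrier G)\<rparr>"

lemma word_congr_in_words:
  "(u, v) \<in> word_congr X R \<Longrightarrow> u \<in> words X \<and> v \<in> words X"
  by (induction rule: word_congr.induct) (simp_all add: words_def)

lemma equiv_word_congr: "equiv (words X) (word_congr X R)"
proof (rule equivI)
  show "word_congr X R \<subseteq> words X \<times> words X"
    by (auto dest: word_congr_in_words)
  show "refl_on (words X) (word_congr X R)"
    by (auto simp: refl_on_def intro: word_congr.refl dest: word_congr_in_words)
  show "sym (word_congr X R)"
    by (rule symI) (rule word_congr.sym)
  show "trans (word_congr X R)"
    by (rule transI) (rule word_congr.trans)
qed

lemma presented_group_mult:
  assumes "u \<in> words X" "v \<in> words X"
  shows "(word_congr X R `` {u}) \<otimes>\<^bsub>presented_group X R\<^esub> (word_congr X R `` {v})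
    = word_congr X R `` {u @ v}"
proof -
  let ?c = "\<lambda>u. word_congr X R `` {u}"
  have eq: "?c (u' @ v') = ?c (u @ v)" if "u' \<in> ?c u" "v' \<in> ?c v" for u' v'
  proof -
    have "(u @ v, u' @ v') \<in> word_congr X R"
      using that by (intro word_congr.append) simp_all
    then show ?thesis
      by (rule equiv_class_eq[OF equiv_word_congr, symmetric])
  qed
  have "u \<in> ?c u" "v \<in> ?c v"
    using assms by (simp_all add: word_congr.refl)
  then have ne: "?c u \<noteq> {}" "?c v \<noteq> {}" by (metis empty_iff)+
  have "(\<Union>u'\<in>?c u. \<Union>v'\<in>?c v. ?c (u' @ v')) = ?c (u @ v)"
    by (rule SUP_eq_const[OF ne(1)], rule SUP_eq_const[OF ne(2)], rule eq)
  then show ?thesis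
    by (simp add: presented_group_def)
qed

lemma word_inverse:
  assumes "u \<in> words X"
  shows "(rev (map (\<lambda>(x, b). (x, \<not> b)) u) @ u, []) \<in> word_congr X R"
  using assms
proof (induction u)
  case Nil
  then show ?case by (simp add: word_congr.refl)
next
  case (Cons a u)
  obtain x b where a: "a = (x, b)" by fastforce
  let ?v = "rev (map (\<lambda>(x, b). (x, \<not> b)) u)"
  have x: "x \<in> X" and u: "u \<in> words X" using Cons.prems by (auto simp: a words_def)
  have v: "?v \<in> words X" using u by (auto simp: words_def)
  have "([(x, \<not> b), (x, b)], []) \<in> word_congr X R"
    using word_congr.cancel[OF x, of "\<not> b"] by simp
  then have "(?v @ [(x, \<not> b), (x, b)] @ u, ?v @ [] @ u) \<in> word_congr X R"
    using u v by (intro word_congr.append word_congr.refl)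
  then have "(?v @ [(x, \<not> b), (x, b)] @ u, []) \<in> word_congr X R"
    using word_congr.trans[OF _ Cons.IH[OF u]] by simp
  then show ?case by (simp add: a)
qed

lemma group_presented_group: "group (presented_group X R)"
proof -
  let ?G = "presented_group X R" and ?c = "\<lambda>u. word_congr X R `` {u}"
  have car: "carrier ?G = ?c ` words X"
    by (auto simp: presented_group_def quotient_def)
  have one: "\<one>\<^bsub>?G\<^esub> = ?c []"
    by (simp add: presented_group_def)
  have app: "u @ v \<in> words X" if "u \<in> words X" "v \<in> words X" for u v :: "'a word"
    using that by (simp add: words_def)
  have nil: "[] \<in> words X" by (simp add: words_def)
  show ?thesis
  proof (rule groupI)
    fix a assume "a \<in> carrier ?G"
    then obtain u where u: "u \<in> words X" "a = ?c u" unfolding car by blast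
    let ?v = "rev (map (\<lambda>(x, b). (x, \<not> b)) u)"
    have v: "?v \<in> words X" using u(1) by (auto simp: words_def)
    have "?c ?v \<otimes>\<^bsub>?G\<^esub> a = \<one>\<^bsub>?G\<^esub>"
      using equiv_class_eq[OF equiv_word_congr word_inverse[OF u(1)]]
      by (simp add: u presented_group_mult v one)
    then show "\<exists>y\<in>carrier ?G. y \<otimes>\<^bsub>?G\<^esub> a = \<one>\<^bsub>?G\<^esub>"
      using v car by blast
  qed (auto simp: car one presented_group_mult app nil)
qed

lemma group_braid_group: "group (braid_group n)"
  unfolding braid_group_def by (rule group_presented_group)

lemma derived_series_stabilizes:
  assumes "group G" "finite (carrier G)"
  shows "\<exists>r. derived_series G (r + 1) = derived_series G r"
proof -
  interpret group G by fact
  let ?D = "\<lambda>k. (derived G ^^ k) (carrier G)"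
  have step: "?D (Suc k) \<subseteq> ?D k" for k
    using derived_incl[OF order_refl exp_of_derived_is_subgroup[OF subgroup_self]] by simp
  have fin: "finite (?D k)" for k
    using exp_of_derived_in_carrier[OF order_refl] assms(2) by (rule finite_subset)
  obtain r where r: "\<And>k. card (?D r) \<le> card (?D k)"
    using ex_has_least_nat[of "\<lambda>_. True" 0 "\<lambda>k. card (?D k)"] by auto
  have "?D (Suc r) = ?D r"
    using card_seteq[OF fin step r] .
  then have "derived_series G (r + 1) = derived_series G r"
    by (simp add: derived_series_def)
  then show ?thesis ..
qed

end

theory Submission
  imports Defs
begin

text \<open>
  For \<open>n \<ge> 6\<close> the commutator subgroup \<open>K\<close> of the braid group is perfect, so a homomorphism
  \<open>f\<close> from \<open>K\<close> satisfies \<open>f K = f K\<^sup>(\<^sup>r\<^sup>) = (f K)\<^sup>(\<^sup>r\<^sup>)\<close>, which lies in the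
  \<open>r\<close>-th derived subgroup of the target for every \<open>r\<close>, in particular for the one at which the
  derived series of the target becomes stationary.

  Perfectness holds for the following reason. A braid relation makes the two generators in it
  conjugate, so all generators \<open>s\<^sub>i\<close> agree modulo \<open>K\<close>, and every quotient
  \<open>s\<^sub>i s\<^sub>k\<inverse>\<close> lies in \<open>K\<close> (\<open>braid_generators_congruent\<close>).
  For neighbours \<open>s\<^sub>i\<close>, \<open>s\<^sub>i\<^sub>+\<^sub>1\<close> there is, as soon as \<open>n \<ge> 6\<close>, a third generator
  \<open>s\<^sub>k\<close> that commutes with both, and then
  \<open>[s\<^sub>i, s\<^sub>i\<^sub>+\<^sub>1] = [s\<^sub>i s\<^sub>k\<inverse>, s\<^sub>i\<^sub>+\<^sub>1 s\<^sub>k\<inverse>] \<in> [K, K]\<close>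
  (\<open>commutator_shift\<close>). Hence all generators commute modulo the normal subgroup \<open>[K, K]\<close>, the
  quotient by it is abelian, and \<open>K \<subseteq> [K, K]\<close> (\<open>derived_subset_of_commuting_generators\<close>).
\<close>

section \<open>Commutators in groups\<close>

lemma (in group) commutator_in_derived:
  assumes "x \<in> H" "y \<in> H"
  shows "x \<otimes> y \<otimes> inv x \<otimes> inv y \<in> derived G H"
  unfolding derived_def using assms by (blast intro: generate.incl)

lemma (in group) commute_inv:
  assumes car: "x \<in> carrier G" "y \<in> carrier G" and comm: "x \<otimes> y = y \<otimes> x"
  shows "x \<otimes> inv y = inv y \<otimes> x"
proof -
  have "inv y \<otimes> x = inv y \<otimes> (x \<otimes> y) \<otimes> inv y"
    using car by (simp add: m_assoc)
  also have "\<dots> = x \<otimes> inv y"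
    using car by (simp add: comm m_assoc[symmetric])
  finally show ?thesis by simp
qed

text \<open>
  Dividing two elements by a common element of their centralizers does not change their
  commutator, but it can move them into a smaller subgroup.
\<close>

lemma (in group) commutator_shift:
  assumes car: "a \<in> carrier G" "b \<in> carrier G" "c \<in> carrier G"
    and ac: "a \<otimes> c = c \<otimes> a" and bc: "b \<otimes> c = c \<otimes> b"
  shows "(a \<otimes> inv c) \<otimes> (b \<otimes> inv c) \<otimes> inv (a \<otimes> inv c) \<otimes> inv (b \<otimes> inv c)
    = a \<otimes> b \<otimes> inv a \<otimes> inv b"
proof -
  have bc': "b \<otimes> inv c = inv c \<otimes> b"
    using commute_inv[OF car(2,3) bc] .
  have "(a \<otimes> inv c) \<otimes> (b \<otimes> inv c) = (a \<otimes> b) \<otimes> (inv c \<otimes> inv c)"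
    using car by (metis bc' inv_closed m_assoc m_closed)
  moreover have "inv (a \<otimes> inv c) \<otimes> inv (b \<otimes> inv c) = (c \<otimes> c) \<otimes> (inv a \<otimes> inv b)"
  proof -
    have "inv (a \<otimes> inv c) = c \<otimes> inv a"
      using car by (simp add: inv_mult_group)
    moreover have "inv (b \<otimes> inv c) = c \<otimes> inv b"
      using car by (simp add: inv_mult_group)
    moreover have "inv a \<otimes> c = c \<otimes> inv a"
      using commute_inv[OF car(3,1)] ac by simp
    ultimately show ?thesis
      using car by (metis inv_closed m_assoc m_closed)
  qed
  moreover have "(inv c \<otimes> inv c) \<otimes> (c \<otimes> c) = \<one>"
    using car by (metis inv_closed inv_mult_group l_inv m_closed)
  ultimately show ?thesis
    using car by (simp add: m_assoc)
      (metis (no_types, lifting) inv_closed l_inv l_one m_assoc m_closed)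
qed

lemma (in group) centralizer_is_subgroup:
  assumes x: "x \<in> carrier G"
  shows "subgroup {y \<in> carrier G. x \<otimes> y = y \<otimes> x} G"
proof (rule subgroupI)
  fix y assume "y \<in> {y \<in> carrier G. x \<otimes> y = y \<otimes> x}"
  then show "inv y \<in> {y \<in> carrier G. x \<otimes> y = y \<otimes> x}"
    using x commute_inv[of x y] by simp
next
  fix y z
  assume "y \<in> {y \<in> carrier G. x \<otimes> y = y \<otimes> x}" "z \<in> {y \<in> carrier G. x \<otimes> y = y \<otimes> x}"
  then show "y \<otimes> z \<in> {y \<in> carrier G. x \<otimes> y = y \<otimes> x}"
    using x by (simp add: m_assoc[symmetric]) (simp add: m_assoc)
qed (use x in auto)

lemma (in group) comm_group_of_commuting_generators:
  assumes S: "S \<subseteq> carrier G" and gen: "generate G S = carrier G"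
    and comm: "\<And>a b. a \<in> S \<Longrightarrow> b \<in> S \<Longrightarrow> a \<otimes> b = b \<otimes> a"
  shows "comm_group G"
proof (rule group_comm_groupI)
  have central: "x \<otimes> y = y \<otimes> x"
    if x: "x \<in> carrier G" and y: "y \<in> carrier G" and xS: "\<And>a. a \<in> S \<Longrightarrow> x \<otimes> a = a \<otimes> x" for x y
  proof -
    have "S \<subseteq> {y \<in> carrier G. x \<otimes> y = y \<otimes> x}" using S xS by auto
    from generate_subgroup_incl[OF this centralizer_is_subgroup[OF x]] show ?thesis
      using gen y by auto
  qed
  fix x y assume xy: "x \<in> carrier G" "y \<in> carrier G"
  have "y \<otimes> a = a \<otimes> y" if "a \<in> S" for a
    using central[of a y] comm that S xy(2) by auto
  then show "x \<otimes> y = y \<otimes> x" using central[of y x] xy by simp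
qed

text \<open>
  The quotient by \<open>N\<close> is generated by the images of \<open>S\<close>, which commute, so it is abelian.
\<close>

lemma (in group) derived_subset_of_commuting_generators:
  assumes N: "N \<lhd> G" and S: "S \<subseteq> carrier G" and gen: "generate G S = carrier G"
    and comm: "\<And>a b. a \<in> S \<Longrightarrow> b \<in> S \<Longrightarrow> a \<otimes> b \<otimes> inv a \<otimes> inv b \<in> N"
  shows "derived G (carrier G) \<subseteq> N"
proof -
  interpret N: normal N G by fact
  interpret Q: group "G Mod N" by (rule N.factorgroup_is_group)
  let ?q = "\<lambda>x. N #> x"
  interpret q: group_hom G "G Mod N" ?q
    by unfold_locales (rule N.r_coset_hom_Mod)
  have commQ: "?q a \<otimes>\<^bsub>G Mod N\<^esub> ?q b = ?q b \<otimes>\<^bsub>G Mod N\<^esub> ?q a" if "a \<in> S" "b \<in> S" for a b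
  proof -
    have car: "a \<in> carrier G" "b \<in> carrier G" using that S by auto
    have "a \<otimes> b = (a \<otimes> b \<otimes> inv a \<otimes> inv b) \<otimes> (b \<otimes> a)"
      using car by (simp add: m_assoc) (simp add: m_assoc[symmetric])
    then have "a \<otimes> b \<in> N #> (b \<otimes> a)"
      using comm[OF that] unfolding r_coset_def by blast
    then have "N #> (a \<otimes> b) = N #> (b \<otimes> a)"
      using repr_independence[OF _ _ N.subgroup_axioms] m_closed[OF car(2,1)] by blast
    then show ?thesis using N.rcos_sum[OF car] N.rcos_sum[OF car(2,1)] by (simp add: FactGroup_def)
  qed
  have "comm_group (G Mod N)"
  proof (rule Q.comm_group_of_commuting_generators)
    show "?q ` S \<subseteq> carrier (G Mod N)" using S q.hom_closed by blast
    show "generate (G Mod N) (?q ` S) = carrier (G Mod N)"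
      using q.generate_img[OF S] gen by (auto simp: FactGroup_def RCOSETS_def)
  qed (use commQ in blast)
  then show ?thesis by (rule derived_minimal[OF N])
qed

section \<open>Groups generated by elements that satisfy the braid relations\<close>

lemma (in group) braid_relation_quotient_in_derived:
  assumes car: "a \<in> carrier G" "b \<in> carrier G"
    and braid: "a \<otimes> b \<otimes> a = b \<otimes> a \<otimes> b"
  shows "b \<otimes> inv a \<in> derived G (carrier G)"
proof -
  \<comment> \<open>The relation says that conjugation by \<open>a b\<close> takes \<open>a\<close> to \<open>b\<close>.\<close>
  have "(a \<otimes> b) \<otimes> a \<otimes> inv (a \<otimes> b) = b"
    using car braid by (metis inv_solve_right' m_assoc m_closed)
  then show ?thesis
    using commutator_in_derived[of "a \<otimes> b" "carrier G" a] car by simp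
qed

text \<open>
  By the braid relations, consecutive generators have the same image in the abelianization, so
  all of them do.
\<close>

lemma (in group) braid_generators_congruent:
  fixes s :: "nat \<Rightarrow> 'a"
  assumes s: "\<And>i. 1 \<le> i \<Longrightarrow> i < n \<Longrightarrow> s i \<in> carrier G"
    and braid: "\<And>i. 1 \<le> i \<Longrightarrow> i + 1 < n \<Longrightarrow> s i \<otimes> s (i + 1) \<otimes> s i = s (i + 1) \<otimes> s i \<otimes> s (i + 1)"
    and ij: "1 \<le> i" "i < n" "1 \<le> j" "j < n"
  shows "s i \<otimes> inv s j \<in> derived G (carrier G)"
proof -
  let ?K = "derived G (carrier G)"
  interpret K: subgroup ?K G by (rule derived_is_subgroup) simp
  have base: "s k \<otimes> inv s 1 \<in> ?K" if "1 \<le> k" "k < n" for k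
    using that
  proof (induction k rule: nat_induct_at_least)
    case base
    then show ?case using s[of 1] by simp
  next
    case (Suc k)
    have car: "s k \<in> carrier G" "s (Suc k) \<in> carrier G" "s 1 \<in> carrier G"
      using s Suc by auto
    have "s (Suc k) \<otimes> inv s k \<in> ?K"
      using braid_relation_quotient_in_derived[OF car(1,2)] braid[of k] Suc by simp
    moreover have "s k \<otimes> inv s 1 \<in> ?K" using Suc by simp
    ultimately have "(s (Suc k) \<otimes> inv s k) \<otimes> (s k \<otimes> inv s 1) \<in> ?K" by (rule K.m_closed)
    moreover have "(s (Suc k) \<otimes> inv s k) \<otimes> (s k \<otimes> inv s 1) = s (Suc k) \<otimes> inv s 1"
      using car by (metis inv_closed inv_solve_left m_assoc m_closed)
    ultimately show ?case by simp
  qed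
  have car: "s i \<in> carrier G" "s j \<in> carrier G" "s 1 \<in> carrier G"
    using s ij by auto
  have "(s i \<otimes> inv s 1) \<otimes> inv (s j \<otimes> inv s 1) \<in> ?K"
    using base ij by blast
  moreover have "(s i \<otimes> inv s 1) \<otimes> inv (s j \<otimes> inv s 1) = s i \<otimes> inv s j"
    using car by (simp add: inv_mult_group) (metis inv_closed inv_solve_left m_assoc m_closed)
  ultimately show ?thesis by simp
qed

text \<open>
  The second derived subgroup is normal, so it is enough that it contains the commutators of
  pairs of generators. These are trivial for distant generators; for neighbours, shift both by
  a third generator far from the two, which turns them into elements of the derived subgroup.
\<close>

lemma (in group) derived_perfect_of_braid_relations:
  fixes s :: "nat \<Rightarrow> 'a"
  assumes n: "n \<ge> 6"
    and s: "\<And>i. 1 \<le> i \<Longrightarrow> i < n \<Longrightarrow> s i \<in> carrier G"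
    and gen: "generate G (s ` {1..<n}) = carrier G"
    and far: "\<And>i j. 1 \<le> i \<Longrightarrow> i + 2 \<le> j \<Longrightarrow> j < n \<Longrightarrow> s i \<otimes> s j = s j \<otimes> s i"
    and braid: "\<And>i. 1 \<le> i \<Longrightarrow> i + 1 < n \<Longrightarrow> s i \<otimes> s (i + 1) \<otimes> s i = s (i + 1) \<otimes> s i \<otimes> s (i + 1)"
  shows "derived G (derived G (carrier G)) = derived G (carrier G)"
proof
  let ?K = "derived G (carrier G)"
  let ?D = "derived G ?K"
  have K: "subgroup ?K G" by (rule derived_is_subgroup) simp
  have "?D \<lhd> G" by (intro derived_is_normal derived_self_is_normal)
  then interpret D: normal ?D G .
  show "?D \<subseteq> ?K" using derived_incl[OF order_refl K] .
  have shifted: "s i \<otimes> s j \<otimes> inv s i \<otimes> inv s j \<in> ?D"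
    if ijk: "1 \<le> i" "i < n" "1 \<le> j" "j < n" "1 \<le> k" "k < n"
      and "s i \<otimes> s k = s k \<otimes> s i" "s j \<otimes> s k = s k \<otimes> s j" for i j k
  proof -
    have "s i \<otimes> inv s k \<in> ?K" "s j \<otimes> inv s k \<in> ?K"
      using braid_generators_congruent[where s = s and n = n] s braid ijk by blast+
    then show ?thesis
      using commutator_in_derived commutator_shift[of "s i" "s j" "s k"] that s by metis
  qed
  have far': "s i \<otimes> s j = s j \<otimes> s i"
    if "1 \<le> i" "i < n" "1 \<le> j" "j < n" "i + 2 \<le> j \<or> j + 2 \<le> i" for i j
    using that far[of i j] far[of j i] by auto
  have comm: "s i \<otimes> s j \<otimes> inv s i \<otimes> inv s j \<in> ?D"
    if ij: "1 \<le> i" "i < n" "1 \<le> j" "j < n" for i j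
  proof (cases "s i \<otimes> s j = s j \<otimes> s i")
    case True
    then have "s i \<otimes> s j \<otimes> inv s i \<otimes> inv s j = \<one>"
      using s ij by (metis inv_closed inv_solve_right' m_assoc m_closed r_inv)
    then show ?thesis by simp
  next
    case False
    then have near: "j \<le> i + 1" "i \<le> j + 1"
      using far'[OF ij] by linarith+
    \<comment> \<open>The index \<open>k\<close> must be at distance at least 2 from both \<open>i\<close> and \<open>j\<close>. If one of them
      is at most 2, then both are at most 3, and 5 is the first index beyond their reach; it
      is available only if there are at least six strands.\<close>
    define k :: nat where "k = (if i \<ge> 3 \<and> j \<ge> 3 then 1 else 5)"
    have k: "1 \<le> k" "k < n" "i + 2 \<le> k \<or> k + 2 \<le> i" "j + 2 \<le> k \<or> k + 2 \<le> j"
      using n near by (auto simp: k_def)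
    show ?thesis
      using shifted[of i j k] far'[of i k] far'[of j k] ij k by blast
  qed
  show "?K \<subseteq> ?D"
    by (rule derived_subset_of_commuting_generators[OF D.normal_axioms _ gen])
      (use s comm in auto)
qed

section \<open>The Artin generators\<close>

abbreviation word_class :: "'a set \<Rightarrow> ('a word \<times> 'a word) set \<Rightarrow> 'a word \<Rightarrow> 'a word set"
  where "word_class X R u \<equiv> word_congr X R `` {u}"

lemma word_class_in_carrier: "u \<in> words X \<Longrightarrow> word_class X R u \<in> carrier (presented_group X R)"
  by (auto simp: presented_group_def quotient_def)

lemma word_class_eqI:
  "(u, v) \<in> R \<Longrightarrow> u \<in> words X \<Longrightarrow> v \<in> words X \<Longrightarrow> word_class X R u = word_class X R v"
  by (intro equiv_class_eq[OF equiv_word_congr] word_congr.relation)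

lemma presented_group_generate:
  "generate (presented_group X R) ((\<lambda>x. word_class X R [(x, True)]) ` X)
    = carrier (presented_group X R)"
proof
  let ?G = "presented_group X R" and ?c = "word_class X R"
  let ?S = "(\<lambda>x. ?c [(x, True)]) ` X"
  interpret group ?G by (rule group_presented_group)
  have one: "\<one>\<^bsub>?G\<^esub> = ?c []" by (simp add: presented_group_def)
  have letter: "[(x, b)] \<in> words X" if "x \<in> X" for x b
    using that by (simp add: words_def)
  have S: "?S \<subseteq> carrier ?G"
    by (intro image_subsetI word_class_in_carrier letter)
  show "generate ?G ?S \<subseteq> carrier ?G" by (rule generate_incl[OF S])
  have "?c u \<in> generate ?G ?S" if "u \<in> words X" for u
    using that
  proof (induction u)
    case Nil
    then show ?case using generate.one[of ?G ?S] by (simp add: one)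
  next
    case (Cons a u)
    obtain x b where a: "a = (x, b)" by fastforce
    have x: "x \<in> X" and u: "u \<in> words X" using Cons.prems by (auto simp: a words_def)
    have pos: "?c [(x, True)] \<in> ?S" using x by blast
    have "?c [(x, b)] \<in> generate ?G ?S"
    proof (cases b)
      case True
      then show ?thesis using generate.incl[OF pos] by simp
    next
      case False
      have "?c [(x, False)] \<otimes>\<^bsub>?G\<^esub> ?c [(x, True)] = \<one>\<^bsub>?G\<^esub>"
        using equiv_class_eq[OF equiv_word_congr word_congr.cancel[OF x, of False]]
        by (simp add: presented_group_mult letter x one)
      then have "inv\<^bsub>?G\<^esub> ?c [(x, True)] = ?c [(x, False)]"
        by (intro inv_equality word_class_in_carrier letter x)
      then show ?thesis using generate.inv[OF pos, of ?G] False by simp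
    qed
    then have "?c [(x, b)] \<otimes>\<^bsub>?G\<^esub> ?c u \<in> generate ?G ?S"
      using Cons.IH[OF u] by (rule generate.eng)
    then show ?case by (simp add: a presented_group_mult letter x u)
  qed
  then show "carrier ?G \<subseteq> generate ?G ?S"
    by (auto simp: presented_group_def quotient_def)
qed

lemma braid_commutator_subgroup_perfect:
  assumes "n \<ge> 6"
  shows "derived (braid_group n) (derived (braid_group n) (carrier (braid_group n)))
    = derived (braid_group n) (carrier (braid_group n))"
proof -
  interpret group "braid_group n" by (rule group_braid_group)
  let ?c = "word_class {1..<n} braid_relations"
  have mult: "?c u \<otimes>\<^bsub>braid_group n\<^esub> ?c v = ?c (u @ v)"
    if "u \<in> words {1..<n}" "v \<in> words {1..<n}" for u v
    unfolding braid_group_def using that by (rule presented_group_mult)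
  show ?thesis
  proof (rule derived_perfect_of_braid_relations[where s = "\<lambda>i. ?c [(i, True)]", OF assms])
    show "?c [(i, True)] \<in> carrier (braid_group n)" if "1 \<le> i" "i < n" for i
      unfolding braid_group_def using that by (intro word_class_in_carrier) (simp add: words_def)
    show "generate (braid_group n) ((\<lambda>i. ?c [(i, True)]) ` {1..<n}) = carrier (braid_group n)"
      unfolding braid_group_def by (rule presented_group_generate)
    show "?c [(i, True)] \<otimes>\<^bsub>braid_group n\<^esub> ?c [(j, True)]
        = ?c [(j, True)] \<otimes>\<^bsub>braid_group n\<^esub> ?c [(i, True)]"
      if "1 \<le> i" "i + 2 \<le> j" "j < n" for i j
    proof -
      have "?c [(i, True), (j, True)] = ?c [(j, True), (i, True)]"
        using that by (intro word_class_eqI) (auto simp: words_def braid_relations_def)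
      then show ?thesis using that by (simp add: mult words_def del: One_nat_def)
    qed
    show "?c [(i, True)] \<otimes>\<^bsub>braid_group n\<^esub> ?c [(i + 1, True)] \<otimes>\<^bsub>braid_group n\<^esub> ?c [(i, True)]
        = ?c [(i + 1, True)] \<otimes>\<^bsub>braid_group n\<^esub> ?c [(i, True)] \<otimes>\<^bsub>braid_group n\<^esub> ?c [(i + 1, True)]"
      if "1 \<le> i" "i + 1 < n" for i
    proof -
      have "?c [(i, True), (i + 1, True), (i, True)] = ?c [(i + 1, True), (i, True), (i + 1, True)]"
        using that by (intro word_class_eqI) (auto simp: words_def braid_relations_def)
      then show ?thesis using that by (simp add: mult words_def del: One_nat_def)
    qed
  qed
qed

section \<open>Homomorphisms from a perfect group\<close>

text \<open>
  A homomorphism maps the \<open>r\<close>-th derived subgroup of its source into that of its target, and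
  the former is the whole source.
\<close>

lemma hom_from_perfect_group:
  assumes "group K" "group H" and perfect: "derived K (carrier K) = carrier K"
  shows "hom K H = hom K (derived_series H r)"
proof
  interpret K: group K by fact
  interpret H: group H by fact
  have sub: "(derived H ^^ r) (carrier H) \<subseteq> carrier H"
    by (rule H.exp_of_derived_in_carrier) simp
  then show "hom K (derived_series H r) \<subseteq> hom K H"
    by (auto simp: hom_def derived_series_def)
  show "hom K H \<subseteq> hom K (derived_series H r)"
  proof
    fix f assume f: "f \<in> hom K H"
    interpret f: group_hom K H f by unfold_locales (rule f)
    have "(derived K ^^ r) (carrier K) = carrier K"
      using perfect by (induction r) simp_all
    then have "f ` carrier K = (derived H ^^ r) (f ` carrier K)"
      using f.exp_of_derived_img[of "carrier K" r] by simp
    also have "\<dots> \<subseteq> (derived H ^^ r) (carrier H)"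
      by (rule H.mono_exp_of_derived) auto
    finally show "f \<in> hom K (derived_series H r)"
      using f by (auto simp: hom_def derived_series_def)
  qed
qed

theorem proposition4:
  fixes \<Sigma> :: "('a, 'b) monoid_scheme" and n :: nat
  assumes "group \<Sigma>" and "finite (carrier \<Sigma>)" and "n \<ge> 6"
  shows "hom (braid_commutator_subgroup n) \<Sigma> =
    hom (braid_commutator_subgroup n)
      (derived_series \<Sigma> (LEAST r. derived_series \<Sigma> (r + 1) = derived_series \<Sigma> r))"
proof -
  interpret B: group "braid_group n" by (rule group_braid_group)
  let ?K = "derived (braid_group n) (carrier (braid_group n))"
  have K: "subgroup ?K (braid_group n)" by (rule B.derived_is_subgroup) simp
  show ?thesis
  proof (rule hom_from_perfect_group)
    show "group (braid_commutator_subgroup n)"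
      unfolding braid_commutator_subgroup_def by (rule B.subgroup_imp_group[OF K])
    show "derived (braid_commutator_subgroup n) (carrier (braid_commutator_subgroup n))
        = carrier (braid_commutator_subgroup n)"
      using B.derived_consistent[OF order_refl K] braid_commutator_subgroup_perfect[OF assms(3)]
      by (simp add: braid_commutator_subgroup_def)
  qed (rule assms(1))
qed

end
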